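(* For all $a,b>0$ with $a\ne b$, $$\left(\frac{\sqrt{2A}+\sqrt{A+G}}{2\sqrt2}\right)^{2/\ln2}A^{1-1/\ln2}<J<\left(\frac{\sqrt{2A}+\sqrt{A+G}}{2\sqrt2}\right)^{8/3}A^{-1/3}$$ and $$\left(\frac{\sqrt{2Q}+\sqrt{Q+A}}{2\sqrt2}\right)^{2/\ln2}Q^{1-1/\ln2}<K<\left(\frac{\sqrt{2Q}+\sqrt{Q+A}}{2\sqrt2}\right)^{8/3}Q^{-1/3}.$$
   Context: For $a,b>0$ with $a\neq b$: $Q=\sqrt{\frac{a^2+b^2}{2}}$, $A=\frac{a+b}{2}$, $G=\sqrt{ab}$, $P=\frac{a-b}{2\arcsin\frac{a-b}{a+b}}$ (first Seiffert mean), $T=\frac{a-b}{2\arctan\frac{a-b}{a+b}}$ (second Seiffert mean), $J=A e^{(A+G)/P-2}$, and $K=Q e^{(Q+A)/T-2}$. *)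

theory Defs
  imports "HOL-Analysis.Analysis"
begin

definition quadratic_mean :: "real \<Rightarrow> real \<Rightarrow> real" where
  "quadratic_mean a b = sqrt ((a\<^sup>2 + b\<^sup>2) / 2)"

definition arithmetic_mean :: "real \<Rightarrow> real \<Rightarrow> real" where
  "arithmetic_mean a b = (a + b) / 2"

definition geometric_mean :: "real \<Rightarrow> real \<Rightarrow> real" where
  "geometric_mean a b = sqrt (a * b)"

(* Both Seiffert means are meant for distinct a, b > 0 only: at a = b the formulas
   evaluate to 0 / 0 = 0, not to the limiting value a. *)

definition seiffert_mean1 :: "real \<Rightarrow> real \<Rightarrow> real" where
  "seiffert_mean1 a b = (a - b) / (2 * arcsin ((a - b) / (a + b)))"

definition seiffert_mean2 :: "real \<Rightarrow> real \<Rightarrow> real" where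
  "seiffert_mean2 a b = (a - b) / (2 * arctan ((a - b) / (a + b)))"

definition J_mean :: "real \<Rightarrow> real \<Rightarrow> real" where
  "J_mean a b = arithmetic_mean a b *
     exp ((arithmetic_mean a b + geometric_mean a b) / seiffert_mean1 a b - 2)"

definition K_mean :: "real \<Rightarrow> real \<Rightarrow> real" where
  "K_mean a b = quadratic_mean a b *
     exp ((quadratic_mean a b + arithmetic_mean a b) / seiffert_mean2 a b - 2)"

end

theory Submission
  imports Defs
begin

text \<open>
  Put \<open>(a - b) / (a + b) = sin \<theta>\<close> for the pair \<open>(A, G)\<close> and \<open>(a - b) / (a + b) = tan \<theta>\<close> for the
  pair \<open>(Q, A)\<close>. In both cases the smaller mean is \<open>cos \<theta>\<close> times the larger mean \<open>M\<close>, and with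
  \<open>x = \<theta> / 2\<close> the claim, divided by \<open>M\<close>, becomes
  \<open>((1 + cos x) / 2) powr (2 / ln 2) < exp (2 x cot x - 2) < ((1 + cos x) / 2) powr (8 / 3)\<close>
  for \<open>0 < \<bar>x\<bar> < \<pi> / 4\<close>. After taking logarithms, both sides tend to \<open>0\<close> as \<open>x\<close> tends to \<open>0\<close>, so it
  suffices to compare derivatives; doing so once more leaves the sign of
  \<open>(1 - cos x) (2 - k - 2 (k - 1) cos x)\<close>, where \<open>k = 4/3\<close> for the upper bound. On this range the
  lower bound is not sharp and already holds for \<open>k = 10/7 < 1 / ln 2\<close>.
\<close>

text \<open>A one-sided limit replaces the value at 0, because \<open>x * cot x\<close> evaluates to
  0 at \<open>x = 0\<close> although its limit there is 1.\<close>

lemma pos_of_deriv_pos_tendsto_0: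
  fixes f f' :: "real \<Rightarrow> real"
  assumes deriv: "\<And>t. 0 < t \<Longrightarrow> t \<le> x \<Longrightarrow> (f has_real_derivative f' t) (at t)"
    and pos: "\<And>t. 0 < t \<Longrightarrow> t < x \<Longrightarrow> 0 < f' t"
    and lim: "(f \<longlongrightarrow> 0) (at_right 0)" and "0 < x"
  shows "0 < f x"
proof -
  have less: "f s < f t" if "0 < s" "s < t" "t \<le> x" for s t
  proof (rule DERIV_pos_imp_increasing_open[OF \<open>s < t\<close>])
    show "\<exists>y. (f has_real_derivative y) (at u) \<and> 0 < y" if "s < u" "u < t" for u
      using that \<open>0 < s\<close> \<open>t \<le> x\<close> deriv[of u] pos[of u] by force
    show "continuous_on {s..t} f"
      by (rule DERIV_continuous_on[of _ _ f'])
        (use that deriv in \<open>auto intro: has_field_derivative_at_within\<close>)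
  qed
  \<comment> \<open>The limit preserves only weak inequalities, so it is compared with
    \<open>f (x / 2)\<close>; the increase from \<open>x / 2\<close> to \<open>x\<close> restores
    strictness.\<close>
  have "\<forall>\<^sub>F s in at_right 0. f s \<le> f (x / 2)"
    unfolding eventually_at_right_field
    using less[of _ "x / 2"] \<open>0 < x\<close> by (intro exI[of _ "x / 2"]) force
  then have "0 \<le> f (x / 2)"
    by (rule tendsto_upperbound[OF lim]) simp
  also have "\<dots> < f x"
    using less \<open>0 < x\<close> by simp
  finally show ?thesis .
qed

lemma tendsto_mult_cot_at_right_0: "((\<lambda>x::real. x * cot x) \<longlongrightarrow> 1) (at_right 0)"
proof -
  have "((\<lambda>x::real. sin x / x) \<longlongrightarrow> 1) (at_right 0)"
    using DERIV_sin[of "0::real"] unfolding DERIV_def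
    by (simp add: filterlim_at_split)
  moreover have "((\<lambda>x::real. cos x) \<longlongrightarrow> 1) (at_right 0)"
    by (auto intro!: tendsto_eq_intros)
  ultimately have "((\<lambda>x::real. cos x / (sin x / x)) \<longlongrightarrow> 1 / 1) (at_right 0)"
    by (intro tendsto_divide) auto
  then show ?thesis
    by (simp add: cot_def mult.commute)
qed

lemma tendsto_ln_cot_at_right_0:
  "((\<lambda>x::real. k * ln ((1 + cos x) / 2) + 1 - x * cot x) \<longlongrightarrow> 0) (at_right 0)"
proof -
  have "((\<lambda>x::real. k * ln ((1 + cos x) / 2)) \<longlongrightarrow> 0) (at_right 0)"
    by (auto intro!: tendsto_eq_intros)
  from tendsto_diff[OF tendsto_add[OF this tendsto_const] tendsto_mult_cot_at_right_0, of 1]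
  show ?thesis by simp
qed

text \<open>The common denominator \<open>(sin x)\<^sup>2\<close> is positive, so only the sign of
  the numerator matters, and that no longer contains \<open>ln\<close> or
  \<open>cot\<close>.\<close>

lemma has_real_derivative_ln_cot:
  fixes x k :: real
  assumes "0 < x" "x < pi"
  shows "((\<lambda>x. k * ln ((1 + cos x) / 2) + 1 - x * cot x) has_real_derivative
    (x - sin x * cos x - k * (sin x * (1 - cos x))) / (sin x)\<^sup>2) (at x)"
proof -
  have s: "0 < sin x"
    using assms by (rule sin_gt_zero)
  have c: "-1 < cos x"
    using cos_monotone_0_pi[of x pi] assms by simp
  have e: "(sin x)\<^sup>2 = (1 - cos x) * (1 + cos x)"
    by (simp add: sin_squared_eq power2_eq_square algebra_simps)
  have 1: "sin x / (1 + cos x) = sin x * (1 - cos x) / (sin x)\<^sup>2"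
    using s c e by (cases "cos x = 1") (auto simp: divide_simps)
  have 2: "x / (sin x)\<^sup>2 - cot x = (x - sin x * cos x) / (sin x)\<^sup>2"
    using s by (simp add: cot_def divide_simps power2_eq_square)
  have "((\<lambda>x. k * ln ((1 + cos x) / 2) + 1 - x * cot x) has_real_derivative
    - k * (sin x / (1 + cos x)) + (x / (sin x)\<^sup>2 - cot x)) (at x)"
    using s c by (auto intro!: derivative_eq_intros DERIV_cot simp: field_simps)
  then show ?thesis
    unfolding 1 2 by (simp add: diff_divide_distrib)
qed

lemma has_real_derivative_ln_cot_numerator:
  fixes x k :: real
  shows "((\<lambda>x. x - sin x * cos x - k * (sin x * (1 - cos x))) has_real_derivative
    (1 - cos x) * (2 - k - 2 * (k - 1) * cos x)) (at x)"
proof -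
  have "((\<lambda>x. x - sin x * cos x - k * (sin x * (1 - cos x))) has_real_derivative
    1 + (sin x)\<^sup>2 - (cos x)\<^sup>2 - k * (cos x * (1 - cos x) + (sin x)\<^sup>2)) (at x)"
    by (rule derivative_eq_intros refl | simp add: power2_eq_square algebra_simps)+
  also have "1 + (sin x)\<^sup>2 - (cos x)\<^sup>2 - k * (cos x * (1 - cos x) + (sin x)\<^sup>2) =
    (1 - cos x) * (2 - k - 2 * (k - 1) * cos x)"
    unfolding sin_squared_eq by (simp add: power2_eq_square algebra_simps)
  finally show ?thesis .
qed

lemma tendsto_ln_cot_numerator_at_right_0:
  "((\<lambda>x::real. x - sin x * cos x - k * (sin x * (1 - cos x))) \<longlongrightarrow> 0) (at_right 0)"
  by (auto intro!: tendsto_eq_intros)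

text \<open>The constant 4/3 solves 2 - k = 2 (k - 1): the second factor becomes 2/3 (1 - cos u),
  positive on the whole range, whereas any larger k makes it negative near 0.\<close>

lemma mult_cot_upper:
  fixes x :: real
  assumes "0 < x" "x < pi"
  shows "x * cot x - 1 < 4 / 3 * ln ((1 + cos x) / 2)"
proof -
  have c: "cos t < 1" if "0 < t" "t < x" for t
    using cos_monotone_0_pi[of 0 t] that assms by simp
  have num: "0 < t - sin t * cos t - 4 / 3 * (sin t * (1 - cos t))" if t: "0 < t" "t < x" for t
  proof (rule pos_of_deriv_pos_tendsto_0[OF has_real_derivative_ln_cot_numerator _
        tendsto_ln_cot_numerator_at_right_0 t(1)])
    show "0 < (1 - cos u) * (2 - 4 / 3 - 2 * (4 / 3 - 1) * cos u)" if "0 < u" "u < t" for u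
      using c[of u] that t by (intro mult_pos_pos) auto
  qed
  have "0 < 4 / 3 * ln ((1 + cos x) / 2) + 1 - x * cot x"
  proof (rule pos_of_deriv_pos_tendsto_0[OF has_real_derivative_ln_cot _
        tendsto_ln_cot_at_right_0 assms(1)])
    show "0 < (t - sin t * cos t - 4 / 3 * (sin t * (1 - cos t))) / (sin t)\<^sup>2"
      if "0 < t" "t < x" for t
      using num[OF that] sin_gt_zero[of t] that assms by auto
  qed (use assms in auto)
  then show ?thesis by simp
qed

text \<open>The second factor 2 - k - 2 (k - 1) cos u must be negative up to pi / 4, which needs k
  at least sqrt 2; 10/7 is a rational between sqrt 2 and 1 / ln 2.\<close>

lemma mult_cot_lower:
  fixes x :: real
  assumes "0 < x" "x \<le> pi / 4"
  shows "10 / 7 * ln ((1 + cos x) / 2) < x * cot x - 1"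
proof -
  \<comment> \<open>For k = 10/7 the second factor is (4 - 6 cos u) / 7, hence the threshold
    2/3.\<close>
  have c: "cos t < 1" "2 / 3 < cos t" if "0 < t" "t < x" for t
  proof -
    show "cos t < 1"
      using cos_monotone_0_pi[of 0 t] that assms by simp
    have "4 / 3 < sqrt 2"
      by (rule real_less_rsqrt) (simp add: power2_eq_square)
    moreover have "cos (pi / 4) < cos t"
      using cos_monotone_0_pi[of t "pi / 4"] that assms by simp
    ultimately show "2 / 3 < cos t"
      by (simp add: cos_45)
  qed
  have num: "0 < - (t - sin t * cos t - 10 / 7 * (sin t * (1 - cos t)))" if t: "0 < t" "t < x" for t
  proof (rule pos_of_deriv_pos_tendsto_0[OF DERIV_minus[OF has_real_derivative_ln_cot_numerator] _
        _ t(1)])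
    show "0 < - ((1 - cos u) * (2 - 10 / 7 - 2 * (10 / 7 - 1) * cos u))" if "0 < u" "u < t" for u
      using c[of u] that t by (simp add: mult_less_0_iff)
    show "((\<lambda>t::real. - (t - sin t * cos t - 10 / 7 * (sin t * (1 - cos t)))) \<longlongrightarrow> 0) (at_right 0)"
      using tendsto_minus[OF tendsto_ln_cot_numerator_at_right_0[of "10 / 7"]] by simp
  qed
  have "0 < - (10 / 7 * ln ((1 + cos x) / 2) + 1 - x * cot x)"
  proof (rule pos_of_deriv_pos_tendsto_0[OF DERIV_minus[OF has_real_derivative_ln_cot] _
        _ assms(1)])
    show "0 < - ((t - sin t * cos t - 10 / 7 * (sin t * (1 - cos t))) / (sin t)\<^sup>2)"
      if "0 < t" "t < x" for t
    proof -
      have "0 < (sin t)\<^sup>2"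
        using sin_gt_zero[of t] that assms by auto
      from divide_pos_pos[OF num[OF that] this] show ?thesis
        by (simp only: minus_divide_left)
    qed
    show "((\<lambda>t::real. - (10 / 7 * ln ((1 + cos t) / 2) + 1 - t * cot t)) \<longlongrightarrow> 0) (at_right 0)"
      using tendsto_minus[OF tendsto_ln_cot_at_right_0[of "10 / 7"]] by simp
  qed (use assms pi_gt_zero in linarith)+
  then show ?thesis by simp
qed

text \<open>Both sides are even in x, so negative angles, that is a < b, come for free.\<close>

lemma mult_cot_bounds:
  fixes x :: real
  assumes "0 < \<bar>x\<bar>" "\<bar>x\<bar> \<le> pi / 4"
  shows "1 / ln 2 * ln ((1 + cos x) / 2) < x * cot x - 1"
    and "x * cot x - 1 < 4 / 3 * ln ((1 + cos x) / 2)"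
proof -
  have even: "\<bar>x\<bar> * cot \<bar>x\<bar> = x * cot x"
    by (simp add: abs_if)
  have c: "0 \<le> cos x"
    using assms by (intro cos_ge_zero) auto
  show "x * cot x - 1 < 4 / 3 * ln ((1 + cos x) / 2)"
    using mult_cot_upper[of "\<bar>x\<bar>"] assms pi_gt_zero unfolding even cos_abs_real by linarith
  \<comment> \<open>Here 25/36 < 7/10 is used. The logarithm below is nonpositive, so the larger
    coefficient gives the smaller product.\<close>
  have "10 / 7 \<le> 1 / ln (2::real)"
    using ln2_le_25_over_36 by (simp add: field_simps)
  moreover have "ln ((1 + cos x) / 2) \<le> 0"
    using c by (subst ln_le_zero_iff) auto
  ultimately have "1 / ln 2 * ln ((1 + cos x) / 2) \<le> 10 / 7 * ln ((1 + cos x) / 2)"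
    by (rule mult_right_mono_neg)
  with mult_cot_lower[of "\<bar>x\<bar>"] assms show "1 / ln 2 * ln ((1 + cos x) / 2) < x * cot x - 1"
    unfolding even cos_abs_real by linarith
qed

text \<open>The half-angle formula removes the inner root: the base is sqrt M (1 + cos x) / 2, and
  the exponent 1 - p / 2 brings the total power of M to 1.\<close>

lemma half_angle_powr:
  fixes M x p :: real
  assumes "0 < M" "\<bar>x\<bar> \<le> pi / 4"
  shows "((sqrt (2 * M) + sqrt (M + M * cos (2 * x))) / (2 * sqrt 2)) powr p * M powr (1 - p / 2) =
    M * exp (p * ln ((1 + cos x) / 2))"
proof -
  have c: "0 \<le> cos x"
    using assms by (intro cos_ge_zero) auto
  have "M + M * cos (2 * x) = 2 * M * (cos x)\<^sup>2"
    unfolding cos_double_cos by (simp add: algebra_simps)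
  then have "sqrt (M + M * cos (2 * x)) = sqrt 2 * sqrt M * cos x"
    using c by (simp add: real_sqrt_mult)
  then have "(sqrt (2 * M) + sqrt (M + M * cos (2 * x))) / (2 * sqrt 2) = sqrt M * ((1 + cos x) / 2)"
    by (simp add: real_sqrt_mult field_simps)
  also have "\<dots> powr p = M powr (p / 2) * ((1 + cos x) / 2) powr p"
    using assms c by (simp only: powr_mult) (simp add: powr_half_sqrt[symmetric] powr_powr)
  finally have "((sqrt (2 * M) + sqrt (M + M * cos (2 * x))) / (2 * sqrt 2)) powr p * M powr (1 - p / 2) =
    (M powr (p / 2) * M powr (1 - p / 2)) * ((1 + cos x) / 2) powr p"
    by simp
  also have "M powr (p / 2) * M powr (1 - p / 2) = M"
    using assms by (simp flip: powr_add)
  also have "((1 + cos x) / 2) powr p = exp (p * ln ((1 + cos x) / 2))"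
    using c by (simp add: powr_def)
  finally show ?thesis .
qed

text \<open>Serves both chains: (M, N) is (A, G) with \<theta> = arcsin v, or (Q, A) with \<theta> =
  arctan v, and E is M + N divided by the Seiffert mean.\<close>

lemma exp_mean_bounds:
  fixes M N \<theta> E :: real
  assumes M: "0 < M" and \<theta>: "\<theta> \<noteq> 0" "\<bar>\<theta>\<bar> \<le> pi / 2"
    and N: "N = M * cos \<theta>" and E: "E = \<theta> * (1 + cos \<theta>) / sin \<theta>"
  shows "((sqrt (2 * M) + sqrt (M + N)) / (2 * sqrt 2)) powr (2 / ln 2) * M powr (1 - 1 / ln 2)
      < M * exp (E - 2)"
    and "M * exp (E - 2)
      < ((sqrt (2 * M) + sqrt (M + N)) / (2 * sqrt 2)) powr (8 / 3) * M powr (- 1 / 3)"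
proof -
  define x where "x = \<theta> / 2"
  have x: "0 < \<bar>x\<bar>" "\<bar>x\<bar> \<le> pi / 4" and \<theta>x: "\<theta> = 2 * x"
    using \<theta> by (auto simp: x_def)
  have "cos x \<noteq> 0"
    using cos_gt_zero_pi[of x] x pi_gt_zero by linarith
  \<comment> \<open>By the double-angle formulas (1 + cos \<theta>) / sin \<theta> = cot x, after
    cancelling cos x.\<close>
  then have "E = 2 * (x * cot x)"
    unfolding E \<theta>x cos_double_cos sin_double by (simp add: cot_def field_simps power2_eq_square)
  then have E': "E - 2 = 2 * (x * cot x - 1)"
    by simp
  note half = half_angle_powr[OF M x(2), folded \<theta>x N]
  show "((sqrt (2 * M) + sqrt (M + N)) / (2 * sqrt 2)) powr (2 / ln 2) * M powr (1 - 1 / ln 2)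
      < M * exp (E - 2)"
    using half[of "2 / ln 2"] mult_cot_bounds(1)[OF x] M unfolding E' by simp
  show "M * exp (E - 2)
      < ((sqrt (2 * M) + sqrt (M + N)) / (2 * sqrt 2)) powr (8 / 3) * M powr (- 1 / 3)"
    using half[of "8 / 3"] mult_cot_bounds(2)[OF x] M unfolding E' by simp
qed

theorem proposition3:
  fixes a b :: real
  assumes "a > 0" and "b > 0" and "a \<noteq> b"
  shows "((sqrt (2 * arithmetic_mean a b) + sqrt (arithmetic_mean a b + geometric_mean a b))
             / (2 * sqrt 2)) powr (2 / ln 2) * arithmetic_mean a b powr (1 - 1 / ln 2)
           < J_mean a b
         \<and> J_mean a b
           < ((sqrt (2 * arithmetic_mean a b) + sqrt (arithmetic_mean a b + geometric_mean a b))
                / (2 * sqrt 2)) powr (8 / 3) * arithmetic_mean a b powr (- 1 / 3)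
         \<and> ((sqrt (2 * quadratic_mean a b) + sqrt (quadratic_mean a b + arithmetic_mean a b))
             / (2 * sqrt 2)) powr (2 / ln 2) * quadratic_mean a b powr (1 - 1 / ln 2)
           < K_mean a b
         \<and> K_mean a b
           < ((sqrt (2 * quadratic_mean a b) + sqrt (quadratic_mean a b + arithmetic_mean a b))
                / (2 * sqrt 2)) powr (8 / 3) * quadratic_mean a b powr (- 1 / 3)"
proof -
  define A G Q v where "A = arithmetic_mean a b" and "G = geometric_mean a b"
    and "Q = quadratic_mean a b" and "v = (a - b) / (a + b)"
  have A: "0 < A"
    using assms by (simp add: A_def arithmetic_mean_def)
  have v: "v \<noteq> 0" "-1 < v" "v < 1"
    using assms by (auto simp: v_def field_simps)
  \<comment> \<open>In the coordinates A and v, the other two means are A sqrt (1 - v^2) and A sqrt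
    (1 + v^2), which are A cos (arcsin v) and A / cos (arctan v).\<close>
  have ab: "a = A * (1 + v)" "b = A * (1 - v)"
    using assms by (auto simp: v_def A_def arithmetic_mean_def field_simps)
  have "a * b = A\<^sup>2 * (1 - v\<^sup>2)"
    unfolding ab by (simp add: power2_eq_square algebra_simps)
  then have G: "G = A * cos (arcsin v)"
    using A v by (simp add: G_def geometric_mean_def real_sqrt_mult cos_arcsin)
  have "(a\<^sup>2 + b\<^sup>2) / 2 = A\<^sup>2 * (1 + v\<^sup>2)"
    unfolding ab by (simp add: power2_eq_square algebra_simps)
  then have Q': "Q = A * sqrt (1 + v\<^sup>2)"
    using A by (simp add: Q_def quadratic_mean_def real_sqrt_mult)
  have r: "0 < sqrt (1 + v\<^sup>2)"
    by (simp add: add_pos_nonneg)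
  have Q: "0 < Q" and AQ: "A = Q * cos (arctan v)"
    using A r by (auto simp: Q' cos_arctan)
  have d: "a - b = 2 * A * v"
    unfolding ab by (simp add: algebra_simps)
  \<comment> \<open>The Seiffert mean is A v / \<theta>, and A v = M sin \<theta> both here and for
    the pair (Q, A) below.\<close>
  have "(A + G) / seiffert_mean1 a b = arcsin v * (1 + cos (arcsin v)) / sin (arcsin v)"
    unfolding seiffert_mean1_def v_def[symmetric] unfolding d G using A v by (simp add: field_simps)
  note J = exp_mean_bounds[OF A _ _ G this]
  have "(Q + A) / seiffert_mean2 a b = arctan v * (1 + cos (arctan v)) / sin (arctan v)"
    unfolding seiffert_mean2_def v_def[symmetric] unfolding d Q' cos_arctan sin_arctan
    using A v r by (simp add: field_simps)
  note K = exp_mean_bounds[OF Q _ _ AQ this]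
  have "arcsin v \<noteq> 0"
    using v sin_arcsin[of v] by (metis less_imp_le sin_zero)
  have "\<bar>arcsin v\<bar> \<le> pi / 2"
    using v arcsin_bounded[of v] by auto
  note J = J[OF \<open>arcsin v \<noteq> 0\<close> this]
  have "arctan v \<noteq> 0" "\<bar>arctan v\<bar> \<le> pi / 2"
    using v arctan_bounded[of v] by auto
  note K = K[OF this]
  show ?thesis
    using J K unfolding J_mean_def K_mean_def A_def G_def Q_def by blast
qed

end
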